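(* Let $\psi_2=\sum_{i=3}^{\infty}\frac{i}{2^{i!}}$. Then $\psi_2$ is a Liouville number, its binary expansion is disjunctive, and $\psi_2$ is not normal to the base $2$.
   Context: A real number $\alpha$ in the unit interval is a Liouville number if for every positive integer $n$ there are integers $p>0$ and $q>1$ such that $0<\left|\alpha-\frac{p}{q}\right|<\frac{1}{q^n}$. A binary expansion $0.x_0x_1x_2\dots$ is disjunctive if every finite string over $\{0,1\}$ occurs in $x_0x_1x_2\dots$ as a block of consecutive digits. The number with this expansion is normal to the base $2$ if for every $m\ge 1$ and every $w\in\{0,1\}^m$, the number of indices $i$ with $0\le i\le j-m$ and $x_i\cdots x_{i+m-1}=w$, divided by $j$, tends to $2^{-m}$ as $j\to\infty$. *)

theory Defs
  imports Complex_Main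
begin

definition liouville_number :: "real \<Rightarrow> bool" where
  "liouville_number \<alpha> \<longleftrightarrow> \<alpha> \<in> {0..1} \<and>
     (\<forall>n::nat. n > 0 \<longrightarrow> (\<exists>p q :: int. p > 0 \<and> q > 1 \<and>
        0 < \<bar>\<alpha> - of_int p / of_int q\<bar> \<and> \<bar>\<alpha> - of_int p / of_int q\<bar> < 1 / of_int q ^ n))"

text \<open>A dyadic rational strictly between 0 and 1 has two binary expansions, so this is a relation.\<close>

definition binary_expansion :: "real \<Rightarrow> (nat \<Rightarrow> nat) \<Rightarrow> bool" where
  "binary_expansion \<alpha> x \<longleftrightarrow> (\<forall>i. x i \<in> {0, 1}) \<and> (\<lambda>i. real (x i) / 2 ^ (i + 1)) sums \<alpha>"

definition occurs_at :: "nat list \<Rightarrow> (nat \<Rightarrow> nat) \<Rightarrow> nat \<Rightarrow> bool" where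
  "occurs_at w x i \<longleftrightarrow> map x [i..<i + length w] = w"

definition disjunctive :: "(nat \<Rightarrow> nat) \<Rightarrow> bool" where
  "disjunctive x \<longleftrightarrow> (\<forall>w. set w \<subseteq> {0, 1} \<longrightarrow> (\<exists>i. occurs_at w x i))"

text \<open>The condition \<open>i + m \<le> j\<close> expresses \<open>i \<le> j - m\<close> without truncated subtraction.\<close>

definition normal_base_2 :: "real \<Rightarrow> bool" where
  "normal_base_2 \<alpha> \<longleftrightarrow> (\<exists>x. binary_expansion \<alpha> x \<and>
     (\<forall>m\<ge>1. \<forall>w. length w = m \<and> set w \<subseteq> {0, 1} \<longrightarrow>
        (\<lambda>j. real (card {i. i + m \<le> j \<and> occurs_at w x i}) / real j) \<longlonglongrightarrow> 1 / 2 ^ m))"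

definition psi_2 :: real where
  "psi_2 = (\<Sum>i. real (i + 3) / 2 ^ fact (i + 3))"

end

(* Writing k! for the position of the lowest digit of k, the tail of the series beyond k is so small
   that floor (2^(k!) * psi_2) is the scaled partial sum N k, and
   N k = k + 2^(k! - (k-1)!) * N (k-1).
   Hence the digits of psi_2 in positions (k-1)! + 1, ..., k! are those of k, padded by zeros on the
   left.  As k runs through all integers, every word appears at the end of such a block; as k has
   only O(log k) digits, almost all of the first k! digits are zeros.  The partial sums are the
   Liouville approximations. *)
theory Submission
  imports Defs
begin

section \<open>Binary digits via floors\<close>

text \<open>Digit \<open>n\<close> has weight \<open>1 / 2 ^ Suc n\<close>, whence the
  \<open>Suc n\<close> under the floor. On a dyadic rational in [0, 1) this selects the expansion
  ending in zeros.\<close>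

definition binary_digit :: "real \<Rightarrow> nat \<Rightarrow> nat" where
  "binary_digit \<alpha> n = nat (\<lfloor>2 ^ Suc n * \<alpha>\<rfloor> mod 2)"

lemma floor_power2_div:
  fixes \<alpha> :: real
  assumes "s \<le> n"
  shows "\<lfloor>2 ^ (n - s) * \<alpha>\<rfloor> = \<lfloor>2 ^ n * \<alpha>\<rfloor> div 2 ^ s"
proof -
  have "\<lfloor>2 ^ n * \<alpha> / real_of_int (2 ^ s)\<rfloor> = \<lfloor>2 ^ n * \<alpha>\<rfloor> div 2 ^ s"
    by (rule floor_divide_real_eq_div) simp
  moreover have "2 ^ n * \<alpha> / real_of_int (2 ^ s) = 2 ^ (n - s) * \<alpha>"
    using assms by (simp add: power_diff)
  ultimately show ?thesis by simp
qed

lemma floor_power2_Suc: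
  "\<lfloor>2 ^ Suc n * \<alpha>\<rfloor> = 2 * \<lfloor>2 ^ n * \<alpha>\<rfloor> + int (binary_digit \<alpha> n)"
  using floor_power2_div[of 1 "Suc n" \<alpha>] by (simp add: binary_digit_def)

text \<open>The first \<open>n\<close> digits spell the integer part of
  \<open>2 ^ n * \<alpha>\<close>, so the partial sums miss \<alpha> by at most
  \<open>1 / 2 ^ n\<close>.\<close>

lemma binary_expansion_binary_digit:
  assumes "0 \<le> \<alpha>" "\<alpha> < 1"
  shows "binary_expansion \<alpha> (binary_digit \<alpha>)"
proof -
  have "binary_digit \<alpha> i < 2" for i
    by (simp add: binary_digit_def nat_less_iff)
  then have digits: "binary_digit \<alpha> i \<in> {0, 1}" for i
    by (auto simp: less_2_cases_iff)
  have partial: "(\<Sum>i<n. real (binary_digit \<alpha> i) / 2 ^ (i + 1)) = of_int \<lfloor>2 ^ n * \<alpha>\<rfloor> / 2 ^ n" for n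
  proof (induction n)
    case 0
    have "\<lfloor>\<alpha>\<rfloor> = 0" using assms by linarith
    then show ?case by simp
  next
    case (Suc n)
    then show ?case by (simp only: sum.lessThan_Suc floor_power2_Suc) (simp add: field_simps)
  qed
  have "(\<lambda>n. (1 / 2) ^ n :: real) \<longlonglongrightarrow> 0"
    by (rule LIMSEQ_realpow_zero) auto
  moreover have "norm (of_int \<lfloor>2 ^ n * \<alpha>\<rfloor> / 2 ^ n - \<alpha>) \<le> norm ((1 / 2) ^ n :: real) * 1" for n
  proof -
    have "\<bar>of_int \<lfloor>2 ^ n * \<alpha>\<rfloor> - 2 ^ n * \<alpha>\<bar> \<le> 1" by linarith
    then have "\<bar>of_int \<lfloor>2 ^ n * \<alpha>\<rfloor> - 2 ^ n * \<alpha>\<bar> / 2 ^ n \<le> 1 / 2 ^ n"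
      by (simp add: divide_right_mono)
    also have "\<bar>of_int \<lfloor>2 ^ n * \<alpha>\<rfloor> - 2 ^ n * \<alpha>\<bar> / 2 ^ n = \<bar>(of_int \<lfloor>2 ^ n * \<alpha>\<rfloor> - 2 ^ n * \<alpha>) / 2 ^ n\<bar>"
      by simp
    also have "(of_int \<lfloor>2 ^ n * \<alpha>\<rfloor> - 2 ^ n * \<alpha>) / 2 ^ n = of_int \<lfloor>2 ^ n * \<alpha>\<rfloor> / 2 ^ n - \<alpha>"
      by (simp add: diff_divide_distrib)
    finally show ?thesis by (simp add: power_one_over)
  qed
  ultimately have "(\<lambda>n. of_int \<lfloor>2 ^ n * \<alpha>\<rfloor> / 2 ^ n - \<alpha>) \<longlonglongrightarrow> 0"
    by (rule tendsto_0_le[OF _ always_eventually[OF allI]])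
  then have "(\<lambda>n. of_int \<lfloor>2 ^ n * \<alpha>\<rfloor> / 2 ^ n) \<longlonglongrightarrow> \<alpha>"
    by (simp add: LIM_zero_iff)
  with digits show ?thesis
    by (simp add: binary_expansion_def sums_def partial[simplified])
qed

text \<open>Scaling by \<open>2 ^ Suc n\<close> splits \<alpha> into an integer \<open>S\<close>,
  made of the digits up to \<open>n\<close>, and a tail \<open>R\<close> in [0, 1]. Non-dyadicity
  excludes \<open>R = 1\<close>, so \<open>S\<close> is the floor and its parity is
  \<open>x n\<close>.\<close>

lemma binary_expansion_unique:
  assumes x: "binary_expansion \<alpha> x" and nondyadic: "\<And>n. 2 ^ n * \<alpha> \<notin> \<int>"
  shows "x = binary_digit \<alpha>"
proof
  fix n
  have digits: "x i \<in> {0, 1}" for i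
    using x by (simp add: binary_expansion_def)
  have sums: "(\<lambda>i. real (x i) / 2 ^ (i + 1)) sums \<alpha>"
    using x by (simp add: binary_expansion_def)
  \<comment> \<open>The last digit is kept apart because every other summand is even.\<close>
  define S where "S = (\<Sum>i<n. x i * 2 ^ (n - i)) + x n"
  define R where "R = 2 ^ Suc n * (\<Sum>i. real (x (i + Suc n)) / 2 ^ (i + Suc n + 1))"
  have term_eq: "2 ^ n * (2 * real (x i)) / 2 ^ (i + 1) = real (x i * 2 ^ (n - i))" if "i \<le> n" for i
    using that unfolding of_nat_mult of_nat_power by (simp add: power_diff)
  have "2 ^ Suc n * (\<Sum>i<Suc n. real (x i) / 2 ^ (i + 1)) = real S"
    unfolding S_def sum.lessThan_Suc distrib_left sum_distrib_left of_nat_add of_nat_sum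
    using term_eq by (intro arg_cong2[where f = "(+)"] sum.cong) auto
  moreover have "\<alpha> = (\<Sum>i. real (x (i + Suc n)) / 2 ^ (i + Suc n + 1)) + (\<Sum>i<Suc n. real (x i) / 2 ^ (i + 1))"
    using suminf_split_initial_segment[OF sums_summable[OF sums], of "Suc n"] sums_unique[OF sums]
    by simp
  ultimately have split: "2 ^ Suc n * \<alpha> = real S + R"
    by (simp add: R_def algebra_simps)
  have summ: "summable (\<lambda>i. real (x (i + Suc n)) / 2 ^ (i + Suc n + 1))"
    using summable_ignore_initial_segment[OF sums_summable[OF sums], of "Suc n"] by simp
  have "(\<lambda>i. (1 / 2) ^ Suc n * (1 / 2) ^ Suc i :: real) sums ((1 / 2) ^ Suc n * 1)"
    by (intro sums_mult power_half_series)
  then have geo: "(\<lambda>i. 1 / 2 ^ (i + Suc n + 1) :: real) sums (1 / 2 ^ Suc n)"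
    by (simp add: power_one_over power_add field_simps)
  have "real (x i) \<le> 1" for i using digits[of i] by auto
  then have "(\<Sum>i. real (x (i + Suc n)) / 2 ^ (i + Suc n + 1)) \<le> (\<Sum>i. 1 / 2 ^ (i + Suc n + 1) :: real)"
    using summ geo by (intro suminf_le divide_right_mono) (auto simp: sums_iff)
  then have "R \<le> 2 ^ Suc n * (1 / 2 ^ Suc n)"
    unfolding R_def sums_unique[OF geo, symmetric] by (intro mult_left_mono) auto
  then have "R \<le> 1" by simp
  moreover have "0 \<le> R"
    unfolding R_def by (intro mult_nonneg_nonneg suminf_nonneg summ) auto
  moreover have "R \<noteq> 1"
  proof
    assume "R = 1"
    then have "2 ^ Suc n * \<alpha> = of_nat (S + 1)" using split by simp
    then show False using nondyadic[of "Suc n"] by (metis Ints_of_nat)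
  qed
  ultimately have "\<lfloor>2 ^ Suc n * \<alpha>\<rfloor> = int S"
    unfolding split by (simp add: floor_eq_iff)
  then have "binary_digit \<alpha> n = S mod 2"
    unfolding binary_digit_def by (simp add: nat_mod_distrib)
  also have "even (\<Sum>i<n. x i * 2 ^ (n - i))"
    by (intro dvd_sum) auto
  then have "S mod 2 = x n mod 2"
    unfolding S_def by (simp add: mod_add_eq[symmetric, of _ "x n"] even_iff_mod_2_eq_zero)
  also have "x n mod 2 = x n" using digits[of n] by auto
  finally show "x n = binary_digit \<alpha> n" ..
qed

section \<open>Partial sums and tails of the series\<close>

definition psi_term :: "nat \<Rightarrow> real" where
  "psi_term i = real i / 2 ^ fact i"

text \<open>This is N k of the overview: the numerator of the partial sum up to index
  \<open>k\<close> over the denominator \<open>2 ^ fact k\<close>. At \<open>k = 2\<close> the sum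
  is empty.\<close>

definition psi_num :: "nat \<Rightarrow> nat" where
  "psi_num k = (\<Sum>i=3..k. i * 2 ^ (fact k - fact i))"

lemma psi_term_pos: "0 < i \<Longrightarrow> 0 < psi_term i"
  by (simp add: psi_term_def)

text \<open>The exponent grows by at least 2, a factor 1/4, while the numerator at most doubles.
  This gives a geometric majorant for the tails.\<close>

lemma psi_term_Suc_le:
  assumes "2 \<le> j"
  shows "psi_term (Suc j) \<le> psi_term j / 2"
proof -
  have "fact j * 2 \<le> fact j * j" using assms by simp
  moreover have "2 \<le> (fact j :: nat)" using fact_ge_self[of j] assms by linarith
  ultimately have "2 \<le> fact j * j" by linarith
  then have "fact j + 2 \<le> (fact (Suc j) :: nat)" by (simp add: algebra_simps)
  then have "(2::real) ^ (fact j + 2) \<le> 2 ^ fact (Suc j)"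
    by (intro power_increasing) auto
  then have "real (Suc j) / 2 ^ fact (Suc j) \<le> real (Suc j) / 2 ^ (fact j + 2)"
    by (intro divide_left_mono) auto
  also have "\<dots> = (real (Suc j) / 4) / 2 ^ fact j" by (simp add: power_add)
  also have "\<dots> \<le> (real j / 2) / 2 ^ fact j"
    using assms by (intro divide_right_mono) auto
  finally show ?thesis by (simp add: psi_term_def)
qed

lemma psi_term_add_le:
  assumes "2 \<le> j"
  shows "psi_term (i + j) \<le> psi_term j * (1 / 2) ^ i"
proof (induction i)
  case (Suc i)
  show ?case using psi_term_Suc_le[of "i + j"] Suc assms by simp
qed simp

lemma summable_psi_term: "summable psi_term"
proof -
  have "summable (\<lambda>i. psi_term 2 * (1 / 2) ^ i)" by (intro summable_mult summable_geometric) simp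
  then have "summable (\<lambda>i. psi_term (i + 2))"
    by (rule summable_comparison_test'[where N = 0])
      (use psi_term_add_le[of 2] psi_term_pos in \<open>auto simp: less_imp_le\<close>)
  then show ?thesis by (simp only: summable_iff_shift)
qed

lemma psi_tail_le:
  assumes "2 \<le> j"
  shows "(\<Sum>i. psi_term (i + j)) \<le> 2 * psi_term j"
proof -
  have "(\<lambda>i. psi_term j * (1 / 2) ^ i) sums (psi_term j * (1 / (1 - 1 / 2)))"
    by (intro sums_mult geometric_sums) simp
  then have geo: "(\<lambda>i. psi_term j * (1 / 2) ^ i) sums (2 * psi_term j)" by (simp add: mult.commute)
  have "(\<Sum>i. psi_term (i + j)) \<le> (\<Sum>i. psi_term j * (1 / 2) ^ i)"
    using psi_term_add_le[OF assms] summable_psi_term geo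
    by (intro suminf_le) (auto simp: summable_iff_shift sums_iff)
  then show ?thesis using geo by (simp add: sums_iff)
qed

lemma psi_tail_pos: "0 < j \<Longrightarrow> 0 < (\<Sum>i. psi_term (i + j))"
  using summable_psi_term psi_term_pos by (intro suminf_pos) (auto simp: summable_iff_shift)

lemma psi_2_split:
  assumes "2 \<le> k"
  shows "psi_2 = real (psi_num k) / 2 ^ fact k + (\<Sum>i. psi_term (i + Suc k))"
proof -
  have "real (psi_num k) / 2 ^ fact k = (\<Sum>i=3..k. psi_term i)"
    unfolding psi_num_def of_nat_sum sum_divide_distrib
    unfolding of_nat_mult of_nat_power
    by (intro sum.cong) (auto simp: psi_term_def power_diff fact_mono)
  also have "\<dots> = (\<Sum>i<k - 2. psi_term (i + 3))"
    using assms by (intro sum.reindex_bij_witness[of _ "\<lambda>i. i + 3" "\<lambda>i. i - 3"]) auto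
  finally have "real (psi_num k) / 2 ^ fact k = (\<Sum>i<k - 2. psi_term (i + 3))" .
  moreover have "(\<Sum>i. psi_term (i + 3)) =
      (\<Sum>i. psi_term (i + (k - 2) + 3)) + (\<Sum>i<k - 2. psi_term (i + 3))"
    using summable_psi_term by (intro suminf_split_initial_segment) (simp add: summable_iff_shift)
  moreover have "i + (k - 2) + 3 = i + Suc k" for i using assms by simp
  ultimately show ?thesis by (simp add: psi_2_def psi_term_def)
qed

lemma psi_2_bounds:
  assumes "2 \<le> k"
  shows "0 < psi_2 - real (psi_num k) / 2 ^ fact k"
    and "psi_2 - real (psi_num k) / 2 ^ fact k \<le> 2 * real (Suc k) / 2 ^ fact (Suc k)"
  using psi_2_split[OF assms] psi_tail_pos[of "Suc k"] psi_tail_le[of "Suc k"] assms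
  by (auto simp: psi_term_def)

text \<open>The numerator of the tail bound costs fewer than \<open>2 * k\<close> bits; both the
  floor and the Liouville estimate leave at least that much room in the exponent.\<close>

lemma double_Suc_less_power2:
  assumes "2 \<le> (k::nat)"
  shows "2 * real (Suc k) < 2 ^ (2 * k)"
proof -
  have "Suc k \<le> 2 ^ k" by (simp add: Suc_le_eq)
  moreover have "(2::nat) ^ 2 \<le> 2 ^ k" using assms by (intro power_increasing) auto
  ultimately have "4 * Suc k \<le> 2 ^ k * 2 ^ k" by (intro mult_mono) auto
  then have "2 * Suc k < 2 ^ (2 * k)" by (simp add: power_add[symmetric] mult_2)
  then have "real (2 * Suc k) < real (2 ^ (2 * k))" by (simp only: of_nat_less_iff)
  then show ?thesis by simp
qed

text \<open>Since \<open>fact k + 2 * k \<le> fact (Suc k)\<close>, the tail scaled by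
  \<open>2 ^ fact k\<close> lies strictly between 0 and 1.\<close>

lemma floor_psi_2:
  assumes "2 \<le> k"
  shows "2 ^ fact k * psi_2 \<notin> \<int>" and "\<lfloor>2 ^ fact k * psi_2\<rfloor> = int (psi_num k)"
proof -
  define d where "d = 2 ^ fact k * psi_2 - real (psi_num k)"
  have d: "d = 2 ^ fact k * (psi_2 - real (psi_num k) / 2 ^ fact k)"
    by (simp add: d_def algebra_simps)
  have "0 < d" using psi_2_bounds(1)[OF assms] by (simp add: d)
  have "(2::nat) \<le> fact k" using fact_ge_self[of k] assms by linarith
  then have "2 * k \<le> fact k * k" by simp
  then have "fact k + 2 * k \<le> (fact (Suc k) :: nat)" by (simp add: algebra_simps)
  then have "(2::real) ^ fact k * 2 ^ (2 * k) \<le> 2 ^ fact (Suc k)"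
    unfolding power_add[symmetric] by (intro power_increasing) auto
  moreover have "2 ^ fact k * (2 * real (Suc k)) < 2 ^ fact k * 2 ^ (2 * k)"
    using double_Suc_less_power2[OF assms] by simp
  ultimately have "2 ^ fact k * (2 * real (Suc k)) < 2 ^ fact (Suc k)" by linarith
  then have "2 ^ fact k * (2 * real (Suc k) / 2 ^ fact (Suc k)) < 1"
    by (simp del: fact_Suc)
  moreover have "d \<le> 2 ^ fact k * (2 * real (Suc k) / 2 ^ fact (Suc k))"
    unfolding d using psi_2_bounds(2)[OF assms] by (intro mult_left_mono) auto
  ultimately have "d < 1" by linarith
  show fl: "\<lfloor>2 ^ fact k * psi_2\<rfloor> = int (psi_num k)"
    using \<open>0 < d\<close> \<open>d < 1\<close> by (simp add: d_def floor_eq_iff)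
  show "2 ^ fact k * psi_2 \<notin> \<int>"
  proof
    assume "2 ^ fact k * psi_2 \<in> \<int>"
    then have "2 ^ fact k * psi_2 = of_int \<lfloor>2 ^ fact k * psi_2\<rfloor>"
      by (simp add: of_int_floor_cancel)
    with \<open>0 < d\<close> fl show False by (simp add: d_def)
  qed
qed

text \<open>Integrality at \<open>n\<close> would pass to every larger exponent, in particular to a
  factorial one, where it has been excluded.\<close>

lemma psi_2_nondyadic: "2 ^ n * psi_2 \<notin> \<int>"
proof
  assume int: "2 ^ n * psi_2 \<in> \<int>"
  have "n \<le> fact (n + 2)" using fact_ge_self[of "n + 2"] by linarith
  then have "2 ^ fact (n + 2) * psi_2 = 2 ^ (fact (n + 2) - n) * (2 ^ n * psi_2)"
    by (simp add: power_diff del: fact_Suc add_2_eq_Suc')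
  also have "\<dots> \<in> \<int>" by (rule Ints_mult[OF _ int]) simp
  finally show False using floor_psi_2(1)[of "n + 2"] by simp
qed

lemma psi_2_range: "0 < psi_2" "psi_2 < 1"
  using psi_2_bounds[of 2] by (auto simp: psi_num_def fact_numeral)

section \<open>Digit blocks between consecutive factorials\<close>

lemma psi_num_Suc:
  assumes "2 \<le> k"
  shows "psi_num (Suc k) = Suc k + psi_num k * 2 ^ (fact (Suc k) - fact k)"
proof -
  have "(i::nat) * 2 ^ (fact (Suc k) - fact i) = i * 2 ^ (fact k - fact i) * 2 ^ (fact (Suc k) - fact k)"
    if "i \<le> k" for i
  proof -
    have "(fact i::nat) \<le> fact k" "(fact k::nat) \<le> fact (Suc k)"
      using that by (auto intro!: fact_mono simp del: fact_Suc)
    then have "(fact (Suc k) - fact i::nat) = (fact k - fact i) + (fact (Suc k) - fact k)" by linarith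
    then show ?thesis by (simp only: power_add mult.assoc)
  qed
  then have "(\<Sum>i=3..k. i * 2 ^ (fact (Suc k) - fact i)) = psi_num k * 2 ^ (fact (Suc k) - fact k)"
    unfolding psi_num_def sum_distrib_right by (intro sum.cong refl) (metis atLeastAtMost_iff)
  then show ?thesis using assms by (simp add: psi_num_def del: fact_Suc)
qed

lemma fact_Suc_diff: "fact (Suc k) - fact k = k * (fact k :: nat)"
  by simp

text \<open>Here \<open>s\<close> counts from the right end of the block of length
  \<open>k * fact k\<close>, with \<open>s = 0\<close> at its last digit. Dropping the lowest
  \<open>s\<close> bits of \<open>psi_num (Suc k)\<close> exposes the digit.\<close>

lemma psi_2_digit:
  assumes "2 \<le> k" "s < k * fact k"
  shows "binary_digit psi_2 (fact (Suc k) - Suc s) = Suc k div 2 ^ s mod 2"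
proof -
  \<comment> \<open>As \<open>s\<close> is strictly below the block length, a factor 2 survives
    division by \<open>2 ^ s\<close>, so the older terms do not affect the parity.\<close>
  obtain t where t: "k * fact k = Suc t + s" using assms(2) by (metis less_iff_Suc_add add.commute add_Suc)
  have le: "Suc s \<le> fact (Suc k)" using assms(2) by simp
  then have "Suc (fact (Suc k) - Suc s) = fact (Suc k) - s" by simp
  then have "\<lfloor>2 ^ Suc (fact (Suc k) - Suc s) * psi_2\<rfloor> = int (psi_num (Suc k)) div 2 ^ s"
    using floor_power2_div[of s "fact (Suc k)" psi_2] floor_psi_2(2)[of "Suc k"] le assms
    by (simp del: fact_Suc power_Suc)
  also have "\<dots> = int (psi_num (Suc k) div 2 ^ s)" by (simp add: zdiv_int)
  finally have "binary_digit psi_2 (fact (Suc k) - Suc s) = psi_num (Suc k) div 2 ^ s mod 2"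
    unfolding binary_digit_def by (simp add: nat_mod_distrib del: fact_Suc power_Suc)
  also have "psi_num (Suc k) = Suc k + (psi_num k * 2 * 2 ^ t) * 2 ^ s"
    unfolding psi_num_Suc[OF assms(1)] fact_Suc_diff t by (simp add: power_add)
  also have "\<dots> div 2 ^ s mod 2 = Suc k div 2 ^ s mod 2"
    by (subst div_mult_self1) (auto simp: mult.assoc mult.left_commute[of _ 2])
  finally show ?thesis .
qed

section \<open>The three properties\<close>

lemma liouville_number_psi_2: "liouville_number psi_2"
  unfolding liouville_number_def
proof (intro conjI allI impI)
  show "psi_2 \<in> {0..1}" using psi_2_range by simp
  fix n :: nat
  \<comment> \<open>Then \<open>fact (Suc k)\<close> equals \<open>n * fact k + 3 * fact k\<close>:
    the first part provides the power \<open>n\<close> of the denominator, the second absorbs the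
    factor \<open>2 * Suc k\<close>.\<close>
  define k where "k = n + 2"
  have k: "2 \<le> k" by (simp add: k_def)
  let ?p = "int (psi_num k)" and ?q = "2 ^ fact k :: int"
  show "\<exists>p q :: int. p > 0 \<and> q > 1 \<and>
        0 < \<bar>psi_2 - of_int p / of_int q\<bar> \<and> \<bar>psi_2 - of_int p / of_int q\<bar> < 1 / of_int q ^ n"
    if "n > 0"
  proof (intro exI conjI)
    \<comment> \<open>The numerator is positive only once the term of index 3 is included.\<close>
    have "3 \<le> k" using that by (simp add: k_def)
    then show "?p > 0"
      unfolding psi_num_def of_nat_0_less_iff by (intro sum_pos) auto
    show "?q > 1" by (rule one_less_power) auto
    have b: "0 < psi_2 - of_int ?p / of_int ?q"
      "psi_2 - of_int ?p / of_int ?q \<le> 2 * real (Suc k) / 2 ^ fact (Suc k)"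
      using psi_2_bounds[OF k] by (simp_all del: fact_Suc)
    then show "0 < \<bar>psi_2 - of_int ?p / of_int ?q\<bar>" by simp
    have "n * fact k + 2 * k \<le> n * fact k + 3 * (fact k :: nat)"
      using fact_ge_self[of k] by simp
    also have "\<dots> = fact (Suc k)" by (simp add: k_def algebra_simps)
    finally have "(2::real) ^ (n * fact k) * 2 ^ (2 * k) \<le> 2 ^ fact (Suc k)"
      unfolding power_add[symmetric] by (intro power_increasing) auto
    moreover have "(2::real) ^ (n * fact k) * (2 * real (Suc k)) < 2 ^ (n * fact k) * 2 ^ (2 * k)"
      using double_Suc_less_power2[OF k] by simp
    ultimately have "2 ^ (n * fact k) * (2 * real (Suc k)) < 2 ^ fact (Suc k)" by linarith
    then have "2 * real (Suc k) / 2 ^ fact (Suc k) < 1 / 2 ^ (n * fact k)"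
      by (simp add: divide_less_eq less_divide_eq mult.commute del: fact_Suc)
    also have "\<dots> = 1 / of_int ?q ^ n" by (simp add: power_mult[symmetric] mult.commute)
    finally show "\<bar>psi_2 - of_int ?p / of_int ?q\<bar> < 1 / of_int ?q ^ n" using b by linarith
  qed
qed

section \<open>Every word as the end of a digit block\<close>

lemma ex_nat_with_binary_digits:
  fixes w :: "nat list"
  assumes "set w \<subseteq> {0, 1}"
  shows "\<exists>v. \<forall>s<length w. v div 2 ^ s mod 2 = w ! s"
  using assms
proof (induction w)
  case (Cons a w)
  then obtain v where v: "\<forall>s<length w. v div 2 ^ s mod 2 = w ! s" by auto
  \<comment> \<open>Words are read from the lowest bit upwards, so prepending a letter is a Horner
    step.\<close>
  have "(a + 2 * v) div 2 ^ s mod 2 = (a # w) ! s" if "s < length (a # w)" for s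
  proof (cases s)
    case 0
    then show ?thesis using Cons.prems by auto
  next
    case (Suc s')
    have "(a + 2 * v) div 2 = v" using Cons.prems by auto
    then show ?thesis using v that Suc by (simp add: div_mult2_eq)
  qed
  then show ?case by blast
qed simp

lemma disjunctive_psi_2: "disjunctive (binary_digit psi_2)"
  unfolding disjunctive_def
proof (intro allI impI)
  fix w :: "nat list"
  define m where "m = length w"
  assume "set w \<subseteq> {0, 1}"
  then obtain v where v: "\<And>s. s < m \<Longrightarrow> v div 2 ^ s mod 2 = rev w ! s"
    using ex_nat_with_binary_digits[of "rev w"] by (auto simp: m_def)
  \<comment> \<open>Adding \<open>2 ^ (m + 2)\<close> to \<open>v\<close> leaves its lowest
    \<open>m\<close> bits alone, and makes \<open>k\<close> large enough for its block to hold the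
    whole word, leading zeros included.\<close>
  define k where "k = v + 2 ^ (m + 2) - 1"
  have "m + 2 < 2 ^ (m + 2)" by (rule less_exp)
  then have k: "Suc k = v + 2 ^ (m + 2)" "2 \<le> k" "m \<le> k" by (simp_all add: k_def)
  have block: "m \<le> k * fact k" using k(3) by (metis fact_ge_1 le_trans mult.right_neutral mult_le_mono2)
  have "m \<le> fact (Suc k)" using block by simp
  have "binary_digit psi_2 (fact (Suc k) - m + j) = w ! j" if "j < m" for j
  proof -
    define s where "s = m - Suc j"
    have s: "s < m" "fact (Suc k) - m + j = fact (Suc k) - Suc s"
      using that \<open>m \<le> fact (Suc k)\<close> by (auto simp: s_def simp del: fact_Suc)
    have split: "2 ^ (m + 2) = (2 * 2 ^ (m + 1 - s)) * (2::nat) ^ s"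
      using s(1) by (simp add: power_add[symmetric] flip: power_Suc)
    have "Suc k div 2 ^ s = 2 * 2 ^ (m + 1 - s) + v div 2 ^ s"
      unfolding k(1) split by (rule div_mult_self1) simp
    then have "Suc k div 2 ^ s mod 2 = v div 2 ^ s mod 2" by simp
    also have "\<dots> = w ! j" using v[OF s(1)] s(1) that by (simp add: rev_nth m_def s_def)
    finally show ?thesis using psi_2_digit[OF k(2), of s] block s by simp
  qed
  then have "occurs_at w (binary_digit psi_2) (fact (Suc k) - m)"
    unfolding occurs_at_def by (intro nth_equalityI) (auto simp: m_def simp del: fact_Suc)
  then show "\<exists>i. occurs_at w (binary_digit psi_2) i" ..
qed

section \<open>Scarcity of ones and failure of normality\<close>

lemma card_ones_psi_2_le:
  assumes "2 \<le> k"
  shows "card {i. i + 1 \<le> fact (Suc k) \<and> occurs_at [1] (binary_digit psi_2) i} \<le> fact k + Suc k"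
proof -
  have "{i. i + 1 \<le> fact (Suc k) \<and> occurs_at [1] (binary_digit psi_2) i}
      \<subseteq> {..<fact k} \<union> {fact (Suc k) - Suc k..<fact (Suc k)}"
  proof
    fix i assume "i \<in> {i. i + 1 \<le> fact (Suc k) \<and> occurs_at [1] (binary_digit psi_2) i}"
    then have i: "i < fact (Suc k)" "binary_digit psi_2 i = 1"
      by (auto simp: occurs_at_def simp del: fact_Suc)
    show "i \<in> {..<fact k} \<union> {fact (Suc k) - Suc k..<fact (Suc k)}"
    proof (rule ccontr)
      assume "\<not> ?thesis"
      then have out: "fact k \<le> i" "i < fact (Suc k) - Suc k" using i by (auto simp del: fact_Suc)
      define s where "s = fact (Suc k) - Suc i"
      have s: "s < fact (Suc k) - fact k" "i = fact (Suc k) - Suc s" "Suc k \<le> s"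
        using out i(1) fact_ge_1[of k] by (auto simp: s_def simp del: fact_Suc)
      \<comment> \<open>This crude bound on the number of bits of \<open>Suc k\<close> replaces the
        logarithm; it suffices because the block has length \<open>k * fact k\<close>.\<close>
      have "Suc k < 2 ^ Suc k" by (rule less_exp)
      also have "(2::nat) ^ Suc k \<le> 2 ^ s" using s(3) by (intro power_increasing) auto
      finally have "Suc k div 2 ^ s = 0" by simp
      then show False
        using psi_2_digit[OF assms, of s] s i(2) unfolding fact_Suc_diff by simp
    qed
  qed
  then have "card {i. i + 1 \<le> fact (Suc k) \<and> occurs_at [1] (binary_digit psi_2) i}
      \<le> card ({..<fact k} \<union> {fact (Suc k) - Suc k..<fact (Suc k)} :: nat set)"
    by (intro card_mono) auto
  also have "\<dots> \<le> card {..<fact k::nat} + card {fact (Suc k) - Suc k..<fact (Suc k)::nat}"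
    by (rule card_Un_le)
  also have "\<dots> \<le> fact k + Suc k" by (simp del: fact_Suc)
  finally show ?thesis .
qed

text \<open>Normality would give the one-letter word \<open>[1]\<close> the frequency 1/2, but along
  the prefixes of length \<open>fact (Suc k)\<close> it is eventually at most 1/4.\<close>

lemma not_normal_psi_2: "\<not> normal_base_2 psi_2"
proof
  assume "normal_base_2 psi_2"
  then obtain x where x: "binary_expansion psi_2 x"
    and lim: "\<And>w m. m \<ge> 1 \<Longrightarrow> length w = m \<and> set w \<subseteq> {0, 1} \<Longrightarrow>
        (\<lambda>j. real (card {i. i + m \<le> j \<and> occurs_at w x i}) / real j) \<longlonglongrightarrow> 1 / 2 ^ m"
    unfolding normal_base_2_def by blast
  have x: "x = binary_digit psi_2"
    using binary_expansion_unique[OF x psi_2_nondyadic] .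
  let ?f = "\<lambda>j. real (card {i. i + 1 \<le> j \<and> occurs_at [1] x i}) / real j"
  have "?f \<longlonglongrightarrow> 1 / 2 ^ 1" by (rule lim) auto
  then have "eventually (\<lambda>j. 1 / 4 < ?f j) sequentially"
    by (rule order_tendstoD) simp
  then obtain J where J: "\<And>j. J \<le> j \<Longrightarrow> 1 / 4 < ?f j"
    by (auto simp: eventually_sequentially)
  \<comment> \<open>The summand \<open>J\<close> moves the prefix past the threshold; 7 gives
    \<open>8 \<le> Suc k\<close>, so that \<open>2 * fact k\<close> is at most a quarter of
    \<open>fact (Suc k)\<close>.\<close>
  define k where "k = J + 7"
  have "J \<le> fact (Suc k)" using fact_ge_self[of "Suc k"] unfolding k_def by linarith
  have "3 * k \<le> (k - 1) * k" by (intro mult_right_mono) (auto simp: k_def)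
  also have "\<dots> \<le> fact (k - 1) * k" using fact_ge_self[of "k - 1"] by (intro mult_right_mono) auto
  also have "\<dots> = fact k" by (subst fact_reduce[of k]) (auto simp: k_def)
  finally have "Suc k \<le> fact k" by (simp add: k_def)
  have "card {i. i + 1 \<le> fact (Suc k) \<and> occurs_at [1] x i} \<le> fact k + Suc k"
    unfolding x by (rule card_ones_psi_2_le) (simp add: k_def)
  also have "\<dots> \<le> 2 * fact k" using \<open>Suc k \<le> fact k\<close> by simp
  finally have "4 * card {i. i + 1 \<le> fact (Suc k) \<and> occurs_at [1] x i} \<le> 8 * fact k" by simp
  also have "\<dots> \<le> Suc k * fact k" by (intro mult_right_mono) (auto simp: k_def)
  also have "\<dots> = fact (Suc k)" by simp
  finally have "real (4 * card {i. i + 1 \<le> fact (Suc k) \<and> occurs_at [1] x i}) \<le> real (fact (Suc k))"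
    by (simp only: of_nat_le_iff)
  then have "?f (fact (Suc k)) \<le> 1 / 4"
    by (simp add: divide_le_eq del: fact_Suc of_nat_fact)
  with J[OF \<open>J \<le> fact (Suc k)\<close>] show False by linarith
qed

text \<open>Unique existence justifies speaking of the binary expansion and keeps the universally
  quantified disjunctivity from being vacuous.\<close>

theorem mainTheorem6:
  shows "liouville_number psi_2 \<and>
    (\<exists>!x. binary_expansion psi_2 x) \<and>
    (\<forall>x. binary_expansion psi_2 x \<longrightarrow> disjunctive x) \<and>
    \<not> normal_base_2 psi_2"
proof -
  have "binary_expansion psi_2 (binary_digit psi_2)"
    using binary_expansion_binary_digit psi_2_range by simp
  moreover have "x = binary_digit psi_2" if "binary_expansion psi_2 x" for x
    using binary_expansion_unique[OF that psi_2_nondyadic] .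
  ultimately show ?thesis
    using liouville_number_psi_2 disjunctive_psi_2 not_normal_psi_2 by metis
qed

end
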